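(* Let $H$ be a numerical semigroup minimally generated by $n_1,\ldots,n_e$. Let $F(\mathbf v)$ be a minimal binomial of $I_H$, with $\mathbf v=(v_1,\ldots,v_e)\in\ker(\Phi_H)$, and let $h=\deg(F(\mathbf v))\in H$. If $i,j$ are indices such that $v_i>0$ and $v_j<0$, then $h-n_i-n_j\notin H$. Moreover, if $f\in\mathrm{PF}(H)$ is such that $h-n_i-n_j\le_H f$, then $F(\mathbf v)$ is an RF-relation of $H$ associated to $f$; that is, there exist an RF-matrix of $f$ and two of its rows $\mathbf m_p,\mathbf m_q$ ($p\neq q$) such that $F(\mathbf v)=F(\mathbf m_p-\mathbf m_q)$.
   Context: A numerical semigroup is an additive submonoid of $\mathbb N=\{0,1,2,\dots\}$ with finite complement. $\mathrm{PF}(H)$ is the set of pseudo-Frobenius numbers: $f\in\mathbb Z\setminus H$ with $f+n_i\in H$ for all $i$. For $b,c\in\mathbb Z$, $b\le_H c$ means $c-b\in H$. $\Bbbk$ is a field, $S=\Bbbk[x_1,\ldots,x_e]$ is graded by $\deg x_i=n_i$, $\mathfrak m=(x_1,\dots,x_e)$, and the toric ideal $I_H$ is the kernel of $S\to\Bbbk[t]$, $x_i\mapsto t^{n_i}$. $\Phi_H:\mathbb Z^e\to\mathbb Z$ is $\Phi_H(a_1,\dots,a_e)=\sum_i a_in_i$. For $\mathbf v\in\mathbb Z^e$ write $\mathbf v=\mathbf v^+-\mathbf v^-$ with $\mathbf v^\pm\in\mathbb N^e$ of disjoint supports, and $F(\mathbf v)=\mathbf x^{\mathbf v^+}-\mathbf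 x^{\mathbf v^-}$. For $\mathbf v\in\ker\Phi_H$, $F(\mathbf v)\in I_H$ is homogeneous of degree $\sum_{v_k>0}v_kn_k$. A binomial $F(\mathbf v)\in I_H$ is minimal if it is part of some minimal set of generators of $I_H$, i.e. its image in $I_H/\mathfrak mI_H$ is nonzero. For $f\in\mathrm{PF}(H)$, an RF-matrix of $f$ is an integer $e\times e$ matrix $(m_{ij})$ with $m_{ii}=-1$, $m_{ij}\ge0$ for $i\ne j$, and $\sum_j m_{ij}n_j=f$ for all $i$ (it need not be unique). An RF-relation of $H$ associated to $f$ is a binomial $F(\mathbf m_p-\mathbf m_q)$, where $\mathbf m_p,\mathbf m_q$ ($p\ne q$) are two rows of some RF-matrix of $f$. *)

theory Defs
  imports
    "HOL-Library.Poly_Mapping"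
    "HOL-Computational_Algebra.Polynomial"
    "HOL-Analysis.Finite_Cartesian_Product"
begin

(* The index set {1,...,e} is a finite type 'e, so e = CARD('e) is arbitrary.  The ring
   S = k[x_1,...,x_e] is the type of finitely supported maps from exponent vectors to k. *)

type_synonym ('e, 'k) mpoly = "('e \<Rightarrow>\<^sub>0 nat) \<Rightarrow>\<^sub>0 'k"

definition numerical_semigroup :: "nat set \<Rightarrow> bool" where
  "numerical_semigroup H \<longleftrightarrow>
     0 \<in> H \<and> (\<forall>a\<in>H. \<forall>b\<in>H. a + b \<in> H) \<and> finite (- H)"

definition generated_by :: "('e::finite \<Rightarrow> nat) \<Rightarrow> 'e set \<Rightarrow> nat set" where
  "generated_by n J = {\<Sum>i\<in>J. a i * n i | a. True}"

(* Minimality refers to index sets J, hence also excludes repetitions among the generators. *)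
definition minimally_generated :: "nat set \<Rightarrow> ('e::finite \<Rightarrow> nat) \<Rightarrow> bool" where
  "minimally_generated H n \<longleftrightarrow>
     generated_by n UNIV = H \<and> (\<forall>J. J \<subset> UNIV \<longrightarrow> generated_by n J \<noteq> H)"

definition le_semigroup :: "nat set \<Rightarrow> int \<Rightarrow> int \<Rightarrow> bool" where
  "le_semigroup H b c \<longleftrightarrow> c - b \<in> int ` H"

(* Pseudo-Frobenius numbers are integers: -1 is one when H is all of the naturals. *)
definition PF :: "nat set \<Rightarrow> ('e::finite \<Rightarrow> nat) \<Rightarrow> int set" where
  "PF H n = {f. f \<notin> int ` H \<and> (\<forall>i. f + int (n i) \<in> int ` H)}"

definition var :: "'e \<Rightarrow> ('e, 'k::field) mpoly" where
  "var i = Poly_Mapping.single (Poly_Mapping.single i 1) 1"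

definition toric_map :: "('e::finite \<Rightarrow> nat) \<Rightarrow> ('e, 'k::field) mpoly \<Rightarrow> 'k poly" where
  "toric_map n p =
     (\<Sum>m\<in>Poly_Mapping.keys p. smult (Poly_Mapping.lookup p m)
        (\<Prod>i\<in>UNIV. monom 1 (n i) ^ Poly_Mapping.lookup m i))"

definition toric_ideal :: "('e::finite \<Rightarrow> nat) \<Rightarrow> ('e, 'k::field) mpoly set" where
  "toric_ideal n = {p. toric_map n p = 0}"

(* The ideal generated by a set is its span in the ring viewed as a module over itself. *)
definition ideal_gen :: "'a::comm_ring_1 set \<Rightarrow> 'a set" where
  "ideal_gen A = module.span (*) A"

definition ideal_mult :: "'a::comm_ring_1 set \<Rightarrow> 'a set \<Rightarrow> 'a set" where
  "ideal_mult A B = ideal_gen {a * b | a b. a \<in> A \<and> b \<in> B}"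

definition max_ideal :: "('e, 'k::field) mpoly set" where
  "max_ideal = ideal_gen (range var)"

(* Weighted degree for deg x_i = n_i; only meaningful for nonzero polynomials. *)
definition wdegree :: "('e::finite \<Rightarrow> nat) \<Rightarrow> ('e, 'k::field) mpoly \<Rightarrow> nat" where
  "wdegree n p =
     Max ((\<lambda>m. \<Sum>i\<in>UNIV. Poly_Mapping.lookup m i * n i) ` Poly_Mapping.keys p)"

definition Phi :: "('e::finite \<Rightarrow> nat) \<Rightarrow> int ^ 'e \<Rightarrow> int" where
  "Phi n a = (\<Sum>i\<in>UNIV. a $ i * int (n i))"

(* As nat truncates negative integers to 0, this is the exponent vector v^+;
   v^- is obtained as (-v)^+. *)
definition pos_part :: "int ^ 'e \<Rightarrow> ('e::finite \<Rightarrow>\<^sub>0 nat)" where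
  "pos_part v = Abs_poly_mapping (\<lambda>i. nat (v $ i))"

definition binomial :: "int ^ 'e \<Rightarrow> ('e::finite, 'k::field) mpoly" where
  "binomial v = Poly_Mapping.single (pos_part v) 1 - Poly_Mapping.single (pos_part (- v)) 1"

(* p lies in I_H and has nonzero image in I_H / m I_H.  For homogeneous p this says that
   p belongs to some minimal system of homogeneous generators of I_H. *)
definition minimal_in_toric_ideal ::
    "('e::finite \<Rightarrow> nat) \<Rightarrow> ('e, 'k::field) mpoly \<Rightarrow> bool" where
  "minimal_in_toric_ideal n p \<longleftrightarrow>
     p \<in> toric_ideal n \<and> p \<notin> ideal_mult max_ideal (toric_ideal n)"

definition RF_matrix :: "('e::finite \<Rightarrow> nat) \<Rightarrow> int \<Rightarrow> int ^ 'e ^ 'e \<Rightarrow> bool" where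
  "RF_matrix n f M \<longleftrightarrow>
     (\<forall>i. M $ i $ i = -1) \<and> (\<forall>i j. i \<noteq> j \<longrightarrow> 0 \<le> M $ i $ j) \<and>
     (\<forall>i. (\<Sum>j\<in>UNIV. M $ i $ j * int (n j)) = f)"

definition RF_relation ::
    "('e::finite \<Rightarrow> nat) \<Rightarrow> int \<Rightarrow> ('e, 'k::field) mpoly \<Rightarrow> bool" where
  "RF_relation n f p \<longleftrightarrow>
     (\<exists>M q r. RF_matrix n f M \<and> q \<noteq> r \<and> p = binomial (M $ q - M $ r))"

end

theory Submission
  imports Defs
begin

text \<open>If \<open>h - n\<^sub>i - n\<^sub>j = \<Sum> a\<^sub>k n\<^sub>k\<close>, then \<open>w = x\<^sub>i x\<^sub>j x\<^sup>a\<close> has degree \<open>h\<close>; it shares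
  the variable \<open>x\<^sub>i\<close> with one monomial of \<open>F(v)\<close> and \<open>x\<^sub>j\<close> with the other. Splitting
  \<open>F(v)\<close> at \<open>w\<close> therefore puts it into \<open>m I\<^sub>H\<close>, against minimality.

  If \<open>f = h - n\<^sub>i - n\<^sub>j + \<Sum> b\<^sub>k n\<^sub>k\<close>, then \<open>v\<^sup>- - e\<^sub>i - e\<^sub>j + b\<close> and \<open>v\<^sup>+ - e\<^sub>i - e\<^sub>j + b\<close>
  both represent \<open>f\<close>, and they serve as rows \<open>i\<close> and \<open>j\<close> of an RF-matrix: because
  \<open>f\<close> is not in \<open>H\<close>, the vector \<open>b\<close> vanishes at \<open>i\<close> and \<open>j\<close>. The remaining rows are arbitrary.\<close>

section \<open>Weighted degrees and binomials of the toric ideal\<close>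

lemma module_mult: "module ((*) :: 'a::comm_ring_1 \<Rightarrow> 'a \<Rightarrow> 'a)"
  by unfold_locales (simp_all add: algebra_simps)

text \<open>The exponent of \<open>t\<close> in the image of a monomial under
  \<open>toric_map\<close>, and the quantity maximised in \<open>wdegree\<close>.\<close>

definition mdegree :: "('e::finite \<Rightarrow> nat) \<Rightarrow> ('e \<Rightarrow>\<^sub>0 nat) \<Rightarrow> nat" where
  "mdegree n p = (\<Sum>i\<in>UNIV. Poly_Mapping.lookup p i * n i)"

lemma mdegree_add: "mdegree n (p + q) = mdegree n p + mdegree n q"
  by (simp add: mdegree_def lookup_add algebra_simps sum.distrib)

lemma mdegree_single: "mdegree n (Poly_Mapping.single i 1) = n i"
proof -
  have "mdegree n (Poly_Mapping.single i 1) = (\<Sum>k\<in>UNIV. if k = i then n k else 0)"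
    unfolding mdegree_def by (rule sum.cong) (auto simp: lookup_single when_def)
  then show ?thesis by simp
qed

lemma lookup_Abs_finite:
  "Poly_Mapping.lookup (Abs_poly_mapping (a :: 'e::finite \<Rightarrow> nat)) = a"
  by (simp add: Abs_poly_mapping_inverse)

lemma lookup_pos_part: "Poly_Mapping.lookup (pos_part v) i = nat (v $ i)"
  by (simp add: pos_part_def lookup_Abs_finite)

text \<open>Exponents outside \<open>keys\<close> carry coefficient 0. For a difference of two
  monomials the sum can thus run over both exponents, and only an inclusion of \<open>keys\<close>
  has to be checked.\<close>

lemma toric_map_superset:
  assumes "finite A" "Poly_Mapping.keys p \<subseteq> A"
  shows "toric_map n p = (\<Sum>m\<in>A. monom (Poly_Mapping.lookup p m) (mdegree n m))"
proof -
  have "(\<Prod>i\<in>UNIV. monom 1 (n i) ^ Poly_Mapping.lookup m i) = (monom 1 (mdegree n m) :: 'b poly)" for m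
  proof -
    have "(\<Prod>i\<in>A. monom 1 (n i) ^ Poly_Mapping.lookup m i)
        = (monom 1 (\<Sum>i\<in>A. Poly_Mapping.lookup m i * n i) :: 'b poly)" for A
      by (induction A rule: infinite_finite_induct)
         (simp_all add: monom_power mult_monom mult.commute)
    then show ?thesis by (simp add: mdegree_def)
  qed
  then have "toric_map n p
      = (\<Sum>m\<in>Poly_Mapping.keys p. monom (Poly_Mapping.lookup p m) (mdegree n m))"
    by (simp add: toric_map_def smult_monom)
  also have "\<dots> = (\<Sum>m\<in>A. monom (Poly_Mapping.lookup p m) (mdegree n m))"
    by (rule sum.mono_neutral_left) (use assms in \<open>auto simp: in_keys_iff\<close>)
  finally show ?thesis .
qed

lemma monomial_diff_in_toric_ideal:
  assumes "mdegree n p = mdegree n q"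
  shows "(Poly_Mapping.single p 1 - Poly_Mapping.single q 1 :: ('e::finite, 'k::field) mpoly)
    \<in> toric_ideal n"
proof (cases "p = q")
  case True
  then show ?thesis by (simp add: toric_ideal_def toric_map_def)
next
  case False
  have "Poly_Mapping.keys (Poly_Mapping.single p 1 - Poly_Mapping.single q 1 :: ('e, 'k) mpoly)
      \<subseteq> {p, q}"
    by (auto simp: in_keys_iff lookup_minus lookup_single when_def split: if_splits)
  then have "toric_map n (Poly_Mapping.single p 1 - Poly_Mapping.single q 1 :: ('e, 'k) mpoly) = 0"
    using False assms
    by (subst toric_map_superset[of "{p, q}"])
       (auto simp: lookup_minus lookup_single add_monom)
  then show ?thesis by (simp add: toric_ideal_def)
qed

text \<open>The common variable factors out, and the remaining binomial is still homogeneous, hence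
  in the toric ideal.\<close>

lemma monomial_diff_in_ideal_mult:
  assumes "mdegree n p = mdegree n q"
  shows "(Poly_Mapping.single (Poly_Mapping.single i 1 + p) 1
      - Poly_Mapping.single (Poly_Mapping.single i 1 + q) 1 :: ('e::finite, 'k::field) mpoly)
    \<in> ideal_mult max_ideal (toric_ideal n)"
proof -
  have "(var i :: ('e, 'k) mpoly) \<in> max_ideal"
    by (simp add: max_ideal_def ideal_gen_def module.span_base[OF module_mult])
  moreover have "(Poly_Mapping.single (Poly_Mapping.single i 1 + p) 1
      - Poly_Mapping.single (Poly_Mapping.single i 1 + q) 1 :: ('e, 'k) mpoly)
    = var i * (Poly_Mapping.single p 1 - Poly_Mapping.single q 1)"
    by (simp add: var_def right_diff_distrib mult_single)
  ultimately show ?thesis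
    using monomial_diff_in_toric_ideal[OF assms, where ?'k = 'k]
    unfolding ideal_mult_def ideal_gen_def
    by (intro module.span_base[OF module_mult]) blast
qed

text \<open>Zero lies in every ideal, so minimality forces the two monomials to be distinct. Both
  then survive in \<open>keys\<close>, and the maximum in \<open>wdegree\<close> is over a single
  value.\<close>

lemma minimal_binomial_wdegree:
  fixes v :: "int ^ 'e::finite"
  assumes "Phi n v = 0"
    and "minimal_in_toric_ideal n (binomial v :: ('e, 'k::field) mpoly)"
  shows "wdegree n (binomial v :: ('e, 'k) mpoly) = mdegree n (pos_part v)"
    and "mdegree n (pos_part (- v)) = mdegree n (pos_part v)"
proof -
  have "int (mdegree n (pos_part v)) - int (mdegree n (pos_part (- v))) = Phi n v"
    by (simp add: mdegree_def lookup_pos_part Phi_def flip: sum_subtractf left_diff_distrib)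
       (rule sum.cong, auto)
  then show eq: "mdegree n (pos_part (- v)) = mdegree n (pos_part v)"
    using assms(1) by simp
  have "(binomial v :: ('e, 'k) mpoly) \<noteq> 0"
    using assms(2)
    by (auto simp: minimal_in_toric_ideal_def ideal_mult_def ideal_gen_def
        module.span_zero[OF module_mult])
  then have "pos_part v \<noteq> pos_part (- v)"
    by (auto simp: binomial_def)
  then have "Poly_Mapping.keys (binomial v :: ('e, 'k) mpoly) = {pos_part v, pos_part (- v)}"
    by (auto simp: binomial_def in_keys_iff lookup_minus lookup_single when_def split: if_splits)
  then show "wdegree n (binomial v :: ('e, 'k) mpoly) = mdegree n (pos_part v)"
    by (simp add: wdegree_def eq flip: mdegree_def)
qed

section \<open>Membership in the semigroup\<close>

lemma generated_by_iff_mdegree: "h \<in> generated_by n UNIV \<longleftrightarrow> (\<exists>p. h = mdegree n p)"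
  unfolding generated_by_def mdegree_def
  by (auto, metis lookup_Abs_finite)

text \<open>Integer vectors replace exponent vectors here because rows of RF-matrices have a
  negative entry and arise by subtracting unit vectors.\<close>

lemma generated_by_iff_Phi:
  "f \<in> int ` generated_by n UNIV \<longleftrightarrow> (\<exists>a. (\<forall>k. 0 \<le> a $ k) \<and> f = Phi n a)"
proof
  assume "f \<in> int ` generated_by n UNIV"
  then obtain b where "f = int (\<Sum>k\<in>UNIV. b k * n k)"
    by (auto simp: generated_by_def)
  then have "f = Phi n (\<chi> k. int (b k))" by (simp add: Phi_def)
  then show "\<exists>a. (\<forall>k. 0 \<le> a $ k) \<and> f = Phi n a"
    by (intro exI[of _ "\<chi> k. int (b k)"]) simp
next
  assume "\<exists>a. (\<forall>k. 0 \<le> a $ k) \<and> f = Phi n a"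
  then obtain a where a: "\<forall>k. 0 \<le> a $ k" "f = Phi n a" by blast
  then have "f = int (\<Sum>k\<in>UNIV. nat (a $ k) * n k)" by (simp add: Phi_def)
  then show "f \<in> int ` generated_by n UNIV"
    unfolding generated_by_def by (rule image_eqI) (intro CollectI exI[of _ "\<lambda>k. nat (a $ k)"] conjI refl TrueI)
qed

section \<open>The degree minus n_i and n_j is a gap\<close>

lemma pos_part_split:
  assumes "v $ i > 0"
  obtains p where "pos_part v = Poly_Mapping.single i 1 + p"
proof
  show "pos_part v = Poly_Mapping.single i 1 + (pos_part v - Poly_Mapping.single i 1)"
    by (rule poly_mapping_eqI)
       (use assms in \<open>auto simp: lookup_add lookup_minus lookup_pos_part lookup_single when_def\<close>)
qed

lemma minimal_binomial_degree_gap: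
  fixes v :: "int ^ 'e::finite"
  assumes Phi: "Phi n v = 0"
    and min: "minimal_in_toric_ideal n (binomial v :: ('e, 'k::field) mpoly)"
    and i: "v $ i > 0" and j: "v $ j < 0"
  shows "int (mdegree n (pos_part v)) - int (n i) - int (n j) \<notin> int ` generated_by n UNIV"
proof
  assume "int (mdegree n (pos_part v)) - int (n i) - int (n j) \<in> int ` generated_by n UNIV"
  then obtain a where "int (mdegree n (pos_part v)) - int (n i) - int (n j) = int (mdegree n a)"
    by (auto simp: generated_by_iff_mdegree)
  then have a: "mdegree n (pos_part v) = n i + n j + mdegree n a"
    by linarith
  obtain p where p: "pos_part v = Poly_Mapping.single i 1 + p"
    using i by (rule pos_part_split)
  obtain q where q: "pos_part (- v) = Poly_Mapping.single j 1 + q"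
    using j by (auto intro: pos_part_split[of "- v" j])
  let ?w = "Poly_Mapping.single i 1 + (Poly_Mapping.single j 1 + a)"
  \<comment> \<open>The two readings of \<open>?w\<close> exhibit the variable it shares with each
    monomial: index \<open>i\<close> for \<open>pos_part v\<close>, index \<open>j\<close> for
    \<open>pos_part (- v)\<close>.\<close>
  have w: "?w = Poly_Mapping.single j 1 + (Poly_Mapping.single i 1 + a)"
    by (simp add: algebra_simps)
  have "mdegree n p = mdegree n (Poly_Mapping.single j 1 + a)"
    using a by (simp add: p mdegree_add mdegree_single del: One_nat_def)
  then have "(Poly_Mapping.single (pos_part v) 1 - Poly_Mapping.single ?w 1 :: ('e, 'k) mpoly)
      \<in> ideal_mult max_ideal (toric_ideal n)"
    unfolding p by (rule monomial_diff_in_ideal_mult)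
  moreover have "mdegree n (Poly_Mapping.single i 1 + a) = mdegree n q"
    using a minimal_binomial_wdegree(2)[OF Phi min]
    by (simp add: q mdegree_add mdegree_single del: One_nat_def)
  then have "(Poly_Mapping.single ?w 1 - Poly_Mapping.single (pos_part (- v)) 1 :: ('e, 'k) mpoly)
      \<in> ideal_mult max_ideal (toric_ideal n)"
    unfolding q w by (rule monomial_diff_in_ideal_mult)
  \<comment> \<open>The monomial of \<open>?w\<close> cancels in this sum, which leaves
    \<open>binomial v\<close>.\<close>
  ultimately have "(Poly_Mapping.single (pos_part v) 1 - Poly_Mapping.single ?w 1)
      + (Poly_Mapping.single ?w 1 - Poly_Mapping.single (pos_part (- v)) 1 :: ('e, 'k) mpoly)
      \<in> ideal_mult max_ideal (toric_ideal n)"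
    unfolding ideal_mult_def ideal_gen_def by (rule module.span_add[OF module_mult])
  then show False
    using min by (simp add: binomial_def minimal_in_toric_ideal_def)
qed

section \<open>Rows of RF-matrices\<close>

lemma Phi_add: "Phi n (a + b) = Phi n a + Phi n b"
  by (simp add: Phi_def algebra_simps sum.distrib)

lemma Phi_diff: "Phi n (a - b) = Phi n a - Phi n b"
  by (simp add: Phi_def algebra_simps sum_subtractf)

lemma Phi_axis: "Phi n (axis k 1) = int (n k)"
proof -
  have "Phi n (axis k 1) = (\<Sum>i\<in>UNIV. if i = k then int (n i) else 0)"
    unfolding Phi_def by (rule sum.cong) (auto simp: axis_def)
  then show ?thesis by simp
qed

lemma Phi_pos_part: "Phi n (\<chi> k. max 0 (v $ k)) = int (mdegree n (pos_part v))"
  unfolding Phi_def mdegree_def lookup_pos_part of_nat_sum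
  by (rule sum.cong) auto

text \<open>Take nonnegative coefficients \<open>a\<close> for \<open>f + n k\<close> and lower the
  entry at \<open>k\<close> by one. If \<open>a $ k\<close> were positive, the result would be
  nonnegative and would put \<open>f\<close> into the semigroup; so
  \<open>a $ k = 0\<close>.\<close>

lemma RF_row_exists:
  assumes "f \<in> PF (generated_by n UNIV) n"
  shows "\<exists>r. r $ k = -1 \<and> (\<forall>l. k \<noteq> l \<longrightarrow> 0 \<le> r $ l) \<and> Phi n r = f"
proof -
  have "f + int (n k) \<in> int ` generated_by n UNIV"
    using assms by (simp add: PF_def)
  then obtain a where a: "\<And>l. 0 \<le> a $ l" "f + int (n k) = Phi n a"
    unfolding generated_by_iff_Phi by blast
  define r where "r = a - axis k 1"
  have r: "Phi n r = f"
    using a(2) by (simp add: r_def Phi_diff Phi_axis)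
  have pos: "0 \<le> r $ l" if "k \<noteq> l" for l
    using a(1)[of l] that by (simp add: r_def axis_def)
  have "\<not> 0 \<le> r $ k"
  proof
    assume "0 \<le> r $ k"
    with pos have "\<forall>l. 0 \<le> r $ l" by metis
    with r have "f \<in> int ` generated_by n UNIV"
      unfolding generated_by_iff_Phi by blast
    with assms show False by (simp add: PF_def)
  qed
  then have "r $ k = -1"
    using a(1)[of k] by (simp add: r_def axis_def)
  with pos r show ?thesis by blast
qed

lemma binomial_RF_relation:
  fixes v :: "int ^ 'e::finite"
  assumes Phi: "Phi n v = 0" and i: "v $ i > 0" and j: "v $ j < 0"
    and f: "f \<in> PF (generated_by n UNIV) n"
    and le: "le_semigroup (generated_by n UNIV)
      (int (mdegree n (pos_part v)) - int (n i) - int (n j)) f"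
  shows "RF_relation n f (binomial v :: ('e, 'k::field) mpoly)"
proof -
  obtain b where b: "\<And>k. 0 \<le> b $ k"
      "f - (int (mdegree n (pos_part v)) - int (n i) - int (n j)) = Phi n b"
    using le unfolding le_semigroup_def generated_by_iff_Phi by blast
  have ij: "i \<noteq> j" using i j by auto
  define rj where "rj = (\<chi> k. max 0 (v $ k)) - axis i 1 - axis j 1 + b"
  \<comment> \<open>Since v^+ - v = v^-, this is v^- - e_i - e_j + b, and the two rows differ by
    \<open>v\<close> by construction.\<close>
  define ri where "ri = rj - v"
  have rj_nth: "rj $ k = max 0 (v $ k) - of_bool (k = i) - of_bool (k = j) + b $ k" for k
    by (simp add: rj_def axis_def)
  have ri_nth: "ri $ k = max 0 (- v $ k) - of_bool (k = i) - of_bool (k = j) + b $ k" for k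
    by (simp add: ri_def rj_nth max_def)
  have rj_f: "Phi n rj = f"
    using b(2) by (simp add: rj_def Phi_diff Phi_add Phi_axis Phi_pos_part)
  then have ri_f: "Phi n ri = f"
    using Phi by (simp add: ri_def Phi_diff)
  \<comment> \<open>At \<open>i\<close> the subtracted 1 is absorbed by \<open>v $ i > 0\<close>;
    for \<open>ri\<close>, the entry at \<open>j\<close> is likewise saved by
    \<open>v $ j < 0\<close>.\<close>
  have pos_rj: "0 \<le> rj $ k" if "j \<noteq> k" for k
    using b(1)[of k] i that by (auto simp: rj_nth)
  have pos_ri: "0 \<le> ri $ k" if "i \<noteq> k" for k
    using b(1)[of k] j that by (auto simp: ri_nth)
  \<comment> \<open>A nonnegative vector with value \<open>f\<close> would place \<open>f\<close> in
    the semigroup.\<close>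
  have gap: "\<exists>k. r $ k < 0" if "Phi n r = f" for r
    using f that generated_by_iff_Phi[of f n] by (force simp: PF_def not_less)
  have "rj $ j < 0" using gap[OF rj_f] pos_rj by (metis not_less)
  \<comment> \<open>As v^+ vanishes at \<open>j\<close>, the entry is \<open>b $ j - 1\<close>;
    being negative, it forces \<open>b $ j = 0\<close>.\<close>
  then have rj_j: "rj $ j = -1" using b(1)[of j] j ij by (simp add: rj_nth)
  have "ri $ i < 0" using gap[OF ri_f] pos_ri by (metis not_less)
  then have ri_i: "ri $ i = -1" using b(1)[of i] i ij by (simp add: ri_nth)
  obtain R where R: "\<And>k. R k $ k = -1" "\<And>k l. k \<noteq> l \<Longrightarrow> 0 \<le> R k $ l" "\<And>k. Phi n (R k) = f"
    using RF_row_exists[OF f] by metis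
  define M where "M = (\<chi> k. if k = i then ri else if k = j then rj else R k)"
  have "RF_matrix n f M"
    unfolding RF_matrix_def Phi_def[symmetric] M_def
    using R pos_ri pos_rj ri_i rj_j ri_f rj_f by simp
  moreover have "v = M $ j - M $ i"
    using ij by (simp add: M_def ri_def)
  ultimately show ?thesis
    unfolding RF_relation_def using ij by metis
qed

theorem theorem3p4:
  fixes H :: "nat set" and n :: "'e::finite \<Rightarrow> nat" and v :: "int ^ 'e"
    and F :: "('e, 'k::field) mpoly" and h :: nat
  assumes "numerical_semigroup H"
    and "minimally_generated H n"
    and "Phi n v = 0"
    and "F = binomial v"
    and "minimal_in_toric_ideal n F"
    and "h = wdegree n F"
  shows "h \<in> H \<and>
    (\<forall>i j. v $ i > 0 \<and> v $ j < 0 \<longrightarrow>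
       int h - int (n i) - int (n j) \<notin> int ` H \<and>
       (\<forall>f\<in>PF H n. le_semigroup H (int h - int (n i) - int (n j)) f \<longrightarrow>
          RF_relation n f F))"
proof -
  have H: "H = generated_by n UNIV"
    using assms(2) by (simp add: minimally_generated_def)
  have min: "minimal_in_toric_ideal n (binomial v :: ('e, 'k) mpoly)"
    using assms(4,5) by simp
  have h: "h = mdegree n (pos_part v)"
    using minimal_binomial_wdegree(1)[OF assms(3) min] assms(4,6) by simp
  have "h \<in> H"
    unfolding H generated_by_iff_mdegree using h by blast
  then show ?thesis
    using minimal_binomial_degree_gap[OF assms(3) min] binomial_RF_relation[OF assms(3), where ?'k = 'k]
    unfolding H h assms(4) by blast
qed

end
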